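(* Let $(X,d)$ be a metric space, let $\{f_n\}_{n\in\mathbb{N}^+}$ be a sequence of uniformly continuous maps $f_n:X\to X$ which is pointwise weak orbitally convergent to a uniformly continuous map $f:X\to X$, and let $x\in X$. Then the following statements are true: (i) $x\in E^{+}(f)$ if and only if there exists $\delta>0$ such that $\bigcup_{m\geq 1}\bigcap_{n\geq m}E^{+}_{x}(f_n,y,\delta)\neq\emptyset$ for each $y\in X$ with $y\neq x$. (ii) $x\in Se(f)$ if and only if there exists $\delta>0$ such that for every $\epsilon>0$, $\bigcup_{m\geq 1}\bigcap_{n\geq m}Se_{x}(f_n,\epsilon,\delta)\neq\emptyset$. (iii) $x\in P(f)$ if and only if for every $\epsilon>0$, $\bigcup_{z\in B^{-}(x,\epsilon)}\bigcap_{\delta>0}\bigcup_{m\geq 1}\bigcap_{n\geq m}P(f_n,z,\delta)\neq\emptyset$. (iv) $x\in Tt(f)$ if and only if for every open set $U$ containing $x$ and every non-empty open set $V$, $\bigcup_{m\geq 1}\bigcap_{n\geq m}Tt(f_n,x,U,V)\neq\emptyset$. (v) $x\in Tm(f)$ if and only if for every open set $U$ containing $x$ and every non-empty open set $V$, the image of the projection map $\bigcup_{m\geq 1}\bigcap_{n\geq m}Tt(f_n,x,U,V)\to\mathbb{N}^{+}$, $(y,k)\mapsto k$, is cofinite in $\mathbb{N}^+$. (vi) If $f$ and all $f_n$ are uniform equivalences and $\{f_n^{-1}\}_{n\in\mathbb{N}^+}$ is pointwise weak orbitally convergent to $f^{-1}$, then $x\in E(f)$ if and only if there exists $\delta>0$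 such that $\bigcup_{m\geq 1}\bigcap_{n\geq m}E_{x}(f_n,y,\delta)\neq\emptyset$ for each $y\in X$ with $y\neq x$.
   Context: $\mathbb{N}=\{0,1,2,\dots\}$, $\mathbb{N}^+=\{1,2,\dots\}$; $f^k$ denotes the $k$-th iterate. $B(x,\epsilon)=\{y\in X: d(x,y)<\epsilon\}$ and $B^{-}(x,\epsilon)=B(x,\epsilon)\setminus\{x\}$. A uniform equivalence of $X$ is a bijection $f:X\to X$ such that both $f$ and $f^{-1}$ are uniformly continuous. A sequence of uniformly continuous maps $g_n:X\to X$ is pointwise weak orbitally convergent to a uniformly continuous $g:X\to X$ if for every $x\in X$, $k\in\mathbb{N}^+$ and $\epsilon>0$ there is $N\in\mathbb{N}^+$ (depending on $x,\epsilon,k$) such that $d(g_n^k(x),g^k(x))<\epsilon$ for all $n\geq N$. For uniformly continuous $g:X\to X$ (for uniform equivalences $g$ in the case of $E(g)$ and $E_x$): - $E^{+}(g)$ is the set of positively expansive points: those $x$ for which there is $\delta>0$ such that for every $y\neq x$, $d(g^n(x),g^n(y))>\delta$ for some $n\in\mathbb{N}$. $E(g)$ is the set of expansive points: same definition with $n\in\mathbb{Z}$. - $E^{+}_{x}(g,y,\epsilon)=\{n\in\mathbb{N}: d(g^n(x),g^n(y))>\epsilon\}$, $E_{x}(g,y,\epsilon)=\{n\in\mathbb{Z}: d(g^n(x),g^n(y))>\epsilon\}$. - $Se(g)$ is the set of sensitive points: those $x$ for which there is $\delta>0$ such that for every open set $U\ni x$ there is $y\in U$ with $d(g^n(x),g^n(y))>\delta$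 for some $n\in\mathbb{N}^+$. $Se_{x}(g,\epsilon,\delta)=\{(y,n)\in B(x,\epsilon)\times\mathbb{N}^+: d(g^n(x),g^n(y))>\delta\}$. - $P(g)$ is the set of points $x\in X$ such that every deleted open neighbourhood of $x$ contains a periodic point of $g$. $P(g,z,\delta)=\{k\in\mathbb{N}^+: d(g^k(z),z)<\delta\}$. - $Tt(g)$ is the set of topologically transitive points: those $x$ such that for every open $U\ni x$ and every non-empty open $V$, the set $N(g,x,U,V)=\{k\in\mathbb{N}^+: g^k(U)\cap V\neq\emptyset\}$ is non-empty. $Tm(g)$ is the set of topologically mixing points: those $x$ such that $N(g,x,U,V)$ is cofinite in $\mathbb{N}^+$ for all such $U,V$. - $Tt(g,x,U,V)=\{(y,k)\in U\times\mathbb{N}^+: g^k(y)\in V\}$. *)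

theory Defs
  imports "HOL-Analysis.Analysis"
begin

text \<open>
  The metric space \<open>(X, d)\<close> is a type of class \<open>metric_space\<close>. Sequences indexed by the positive
  integers are functions on \<open>nat\<close> whose value at \<open>0\<close> is never used.
\<close>

definition uniform_equivalence :: "('a::metric_space \<Rightarrow> 'a) \<Rightarrow> bool" where
  "uniform_equivalence g \<longleftrightarrow>
     bij g \<and> uniformly_continuous_on UNIV g \<and> uniformly_continuous_on UNIV (inv g)"

definition pointwise_weak_orbitally_convergent ::
    "(nat \<Rightarrow> 'a::metric_space \<Rightarrow> 'a) \<Rightarrow> ('a \<Rightarrow> 'a) \<Rightarrow> bool" where
  "pointwise_weak_orbitally_convergent G g \<longleftrightarrow>
     (\<forall>x. \<forall>k\<ge>1. \<forall>\<epsilon>>0. \<exists>N\<ge>1. \<forall>n\<ge>N. dist ((G n ^^ k) x) ((g ^^ k) x) < \<epsilon>)"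

text \<open>The integer iterate is meaningful only for bijective \<open>g\<close>.\<close>

definition int_iterate :: "('a \<Rightarrow> 'a) \<Rightarrow> int \<Rightarrow> 'a \<Rightarrow> 'a" where
  "int_iterate g n = (if n \<ge> 0 then g ^^ nat n else inv g ^^ nat (- n))"

definition pos_expansive_points :: "('a::metric_space \<Rightarrow> 'a) \<Rightarrow> 'a set" where
  "pos_expansive_points g =
     {x. \<exists>\<delta>>0. \<forall>y. y \<noteq> x \<longrightarrow> (\<exists>n::nat. dist ((g ^^ n) x) ((g ^^ n) y) > \<delta>)}"

definition pos_expansive_times ::
    "'a::metric_space \<Rightarrow> ('a \<Rightarrow> 'a) \<Rightarrow> 'a \<Rightarrow> real \<Rightarrow> nat set" where
  "pos_expansive_times x g y \<epsilon> = {n. dist ((g ^^ n) x) ((g ^^ n) y) > \<epsilon>}"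

definition expansive_points :: "('a::metric_space \<Rightarrow> 'a) \<Rightarrow> 'a set" where
  "expansive_points g =
     {x. \<exists>\<delta>>0. \<forall>y. y \<noteq> x \<longrightarrow> (\<exists>n::int. dist (int_iterate g n x) (int_iterate g n y) > \<delta>)}"

definition expansive_times ::
    "'a::metric_space \<Rightarrow> ('a \<Rightarrow> 'a) \<Rightarrow> 'a \<Rightarrow> real \<Rightarrow> int set" where
  "expansive_times x g y \<epsilon> = {n. dist (int_iterate g n x) (int_iterate g n y) > \<epsilon>}"

definition sensitive_points :: "('a::metric_space \<Rightarrow> 'a) \<Rightarrow> 'a set" where
  "sensitive_points g =
     {x. \<exists>\<delta>>0. \<forall>U. open U \<and> x \<in> U \<longrightarrow>
           (\<exists>y\<in>U. \<exists>n\<ge>1. dist ((g ^^ n) x) ((g ^^ n) y) > \<delta>)}"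

definition sensitive_pairs ::
    "'a::metric_space \<Rightarrow> ('a \<Rightarrow> 'a) \<Rightarrow> real \<Rightarrow> real \<Rightarrow> ('a \<times> nat) set" where
  "sensitive_pairs x g \<epsilon> \<delta> =
     {(y, n). y \<in> ball x \<epsilon> \<and> n \<ge> 1 \<and> dist ((g ^^ n) x) ((g ^^ n) y) > \<delta>}"

definition periodic_point :: "('a \<Rightarrow> 'a) \<Rightarrow> 'a \<Rightarrow> bool" where
  "periodic_point g z \<longleftrightarrow> (\<exists>k\<ge>1. (g ^^ k) z = z)"

definition periodic_limit_points :: "('a::metric_space \<Rightarrow> 'a) \<Rightarrow> 'a set" where
  "periodic_limit_points g =
     {x. \<forall>U. open U \<and> x \<in> U \<longrightarrow> (\<exists>z \<in> U - {x}. periodic_point g z)}"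

definition return_times :: "('a::metric_space \<Rightarrow> 'a) \<Rightarrow> 'a \<Rightarrow> real \<Rightarrow> nat set" where
  "return_times g z \<delta> = {k. k \<ge> 1 \<and> dist ((g ^^ k) z) z < \<delta>}"

text \<open>
  In \<open>hitting_times\<close> and \<open>hitting_pairs\<close> the point \<open>x\<close> only records which point \<open>U\<close> is a
  neighbourhood of; the sets do not depend on it.
\<close>

definition hitting_times ::
    "('a::metric_space \<Rightarrow> 'a) \<Rightarrow> 'a \<Rightarrow> 'a set \<Rightarrow> 'a set \<Rightarrow> nat set" where
  "hitting_times g x U V = {k. k \<ge> 1 \<and> (g ^^ k) ` U \<inter> V \<noteq> {}}"

definition hitting_pairs ::
    "('a::metric_space \<Rightarrow> 'a) \<Rightarrow> 'a \<Rightarrow> 'a set \<Rightarrow> 'a set \<Rightarrow> ('a \<times> nat) set" where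
  "hitting_pairs g x U V = {(y, k). y \<in> U \<and> k \<ge> 1 \<and> (g ^^ k) y \<in> V}"

definition cofinite_in_pos :: "nat set \<Rightarrow> bool" where
  "cofinite_in_pos A \<longleftrightarrow> A \<subseteq> {1..} \<and> finite ({1..} - A)"

definition transitive_points :: "('a::metric_space \<Rightarrow> 'a) \<Rightarrow> 'a set" where
  "transitive_points g =
     {x. \<forall>U V. open U \<and> x \<in> U \<and> open V \<and> V \<noteq> {} \<longrightarrow> hitting_times g x U V \<noteq> {}}"

definition mixing_points :: "('a::metric_space \<Rightarrow> 'a) \<Rightarrow> 'a set" where
  "mixing_points g =
     {x. \<forall>U V. open U \<and> x \<in> U \<and> open V \<and> V \<noteq> {} \<longrightarrow> cofinite_in_pos (hitting_times g x U V)}"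

end

theory Submission
  imports Defs
begin

text \<open>
  For fixed \<open>k\<close> and \<open>y\<close> the iterates \<open>f\<^sub>n\<^sup>k(y)\<close> converge to \<open>f\<^sup>k(y)\<close>, and a strict or open condition on
  a limit holds eventually along the sequence. Conversely, an eventual strict (open) condition only
  yields the weak (closed) condition on the limit, so one passes to \<open>\<delta>/2\<close> in the expansive and
  sensitive cases, and to a closed ball inside \<open>V\<close> in the transitive and mixing cases.
\<close>

section \<open>Eventual membership and limits along orbits\<close>

text \<open>The left side is the set-theoretic lower limit of the sets \<open>S n\<close>; reading
  it as eventual membership makes the filter and limit rules available. Thresholds starting at 1
  cost nothing, since any threshold can be raised.\<close>

lemma UN_INT_eq_eventually:
  "(\<Union>m\<in>{1..}. \<Inter>n\<in>{m..}. S n) = {a. \<forall>\<^sub>F n in sequentially. a \<in> S n}"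
proof -
  have "(\<exists>m\<ge>1. \<forall>n\<ge>m. P n) \<longleftrightarrow> (\<forall>\<^sub>F n in sequentially. P n)" for P :: "nat \<Rightarrow> bool"
    unfolding eventually_sequentially by (metis le_trans nat_le_linear)
  then show ?thesis
    unfolding set_eq_iff UN_iff INT_iff Bex_def Ball_def atLeast_iff mem_Collect_eq by simp
qed

text \<open>The hypothesis speaks of exponents from 1 on. Exponent 0, which
  \<open>pos_expansive_times\<close> also admits, gives a constant sequence.\<close>

lemma pointwise_weak_orbitally_convergent_tendsto:
  assumes "pointwise_weak_orbitally_convergent G g"
  shows "(\<lambda>n. (G n ^^ k) y) \<longlonglongrightarrow> (g ^^ k) y"
proof (cases "k = 0")
  case False
  then have "k \<ge> 1" by simp
  then show ?thesis
    using assms unfolding pointwise_weak_orbitally_convergent_def lim_sequentially by meson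
qed simp

text \<open>The sign of \<open>k\<close> does not vary with \<open>n\<close>, so all terms and the
  limit take the same branch of \<open>int_iterate\<close>.\<close>

lemma int_iterate_tendsto:
  assumes "pointwise_weak_orbitally_convergent G g"
    and "pointwise_weak_orbitally_convergent (\<lambda>n. inv (G n)) (inv g)"
  shows "(\<lambda>n. int_iterate (G n) k y) \<longlonglongrightarrow> int_iterate g k y"
  using assms[THEN pointwise_weak_orbitally_convergent_tendsto]
  by (simp add: int_iterate_def)

lemma eventually_dist_greater:
  assumes "u \<longlonglongrightarrow> a" "v \<longlonglongrightarrow> b" "dist a b > \<delta>"
  shows "\<forall>\<^sub>F n in sequentially. dist (u n) (v n) > \<delta>"
  using order_tendstoD(1)[OF tendsto_dist[OF assms(1,2)] assms(3)] .

lemma dist_limit_greater_half: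
  fixes u v :: "nat \<Rightarrow> 'a::metric_space"
  assumes "u \<longlonglongrightarrow> a" "v \<longlonglongrightarrow> b" "\<forall>\<^sub>F n in sequentially. dist (u n) (v n) > \<delta>" "\<delta> > 0"
  shows "dist a b > \<delta> / 2"
proof -
  have "\<forall>\<^sub>F n in sequentially. \<delta> \<le> dist (u n) (v n)"
    using assms(3) by eventually_elim simp
  then have "\<delta> \<le> dist a b"
    using tendsto_lowerbound[OF tendsto_dist[OF assms(1,2)]] by simp
  with assms(4) show ?thesis by simp
qed

section \<open>Positively expansive and expansive points\<close>

text \<open>The index type is left free so that natural exponents give the positively expansive case
  and integer exponents the expansive one. Both directions keep the same \<open>y\<close> and
  \<open>i\<close>, so pointwise convergence at \<open>x\<close> and \<open>y\<close>
  suffices.\<close>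

lemma orbit_expansive_iff:
  fixes a :: "'i \<Rightarrow> 'b \<Rightarrow> 'a::metric_space"
  assumes lim: "\<And>i y. (\<lambda>n. A n i y) \<longlonglongrightarrow> a i y"
  shows "(\<exists>\<delta>>0. \<forall>y. y \<noteq> x \<longrightarrow> (\<exists>i. dist (a i x) (a i y) > \<delta>)) \<longleftrightarrow>
    (\<exists>\<delta>>0. \<forall>y. y \<noteq> x \<longrightarrow>
      (\<exists>i. \<forall>\<^sub>F n in sequentially. dist (A n i x) (A n i y) > \<delta>))" (is "?L \<longleftrightarrow> ?R")
proof
  assume ?L
  then show ?R using eventually_dist_greater[OF lim lim] by meson
next
  assume ?R
  then obtain \<delta> where "\<delta> > 0" and
    "\<forall>y. y \<noteq> x \<longrightarrow> (\<exists>i. \<forall>\<^sub>F n in sequentially. dist (A n i x) (A n i y) > \<delta>)" by auto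
  \<comment> \<open>The halved constant is still the same for all \<open>y\<close>, as
    \<open>?L\<close> demands.\<close>
  then have "\<forall>y. y \<noteq> x \<longrightarrow> (\<exists>i. dist (a i x) (a i y) > \<delta> / 2)"
    using dist_limit_greater_half[OF lim lim _ \<open>\<delta> > 0\<close>] by meson
  with \<open>\<delta> > 0\<close> show ?L by (intro exI[of _ "\<delta> / 2"]) simp
qed

lemma pos_expansive_points_iff:
  fixes f :: "'a::metric_space \<Rightarrow> 'a"
  assumes "pointwise_weak_orbitally_convergent F f"
  shows "x \<in> pos_expansive_points f \<longleftrightarrow>
    (\<exists>\<delta>>0. \<forall>y. y \<noteq> x \<longrightarrow>
      (\<Union>m\<in>{1..}. \<Inter>n\<in>{m..}. pos_expansive_times x (F n) y \<delta>) \<noteq> {})"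
  using orbit_expansive_iff[of "\<lambda>n k. F n ^^ k" "\<lambda>k. f ^^ k" x,
      OF pointwise_weak_orbitally_convergent_tendsto[OF assms]]
  unfolding UN_INT_eq_eventually pos_expansive_points_def pos_expansive_times_def by simp

lemma expansive_points_iff:
  fixes f :: "'a::metric_space \<Rightarrow> 'a"
  assumes "pointwise_weak_orbitally_convergent F f"
    and "pointwise_weak_orbitally_convergent (\<lambda>n. inv (F n)) (inv f)"
  shows "x \<in> expansive_points f \<longleftrightarrow>
    (\<exists>\<delta>>0. \<forall>y. y \<noteq> x \<longrightarrow>
      (\<Union>m\<in>{1..}. \<Inter>n\<in>{m..}. expansive_times x (F n) y \<delta>) \<noteq> {})"
  using orbit_expansive_iff[of "\<lambda>n k. int_iterate (F n) k" "\<lambda>k. int_iterate f k" x,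
      OF int_iterate_tendsto[OF assms]]
  unfolding UN_INT_eq_eventually expansive_points_def expansive_times_def by simp

section \<open>Sensitive points\<close>

text \<open>Balls around \<open>x\<close> form a neighbourhood base, and a witness in a smaller set
  is a witness in a larger one, so balls can replace open sets under one fixed
  \<open>\<delta>\<close>.\<close>

lemma sensitive_points_iff_ball:
  "x \<in> sensitive_points g \<longleftrightarrow>
    (\<exists>\<delta>>0. \<forall>\<epsilon>>0. \<exists>y\<in>ball x \<epsilon>. \<exists>k\<ge>1. dist ((g ^^ k) x) ((g ^^ k) y) > \<delta>)"
proof -
  have "(\<forall>U. open U \<and> x \<in> U \<longrightarrow> (\<exists>y\<in>U. P y)) \<longleftrightarrow> (\<forall>\<epsilon>>0. \<exists>y\<in>ball x \<epsilon>. P y)" for P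
  proof
    assume "\<forall>\<epsilon>>0. \<exists>y\<in>ball x \<epsilon>. P y"
    then show "\<forall>U. open U \<and> x \<in> U \<longrightarrow> (\<exists>y\<in>U. P y)"
      unfolding open_contains_ball by blast
  qed simp
  then show ?thesis unfolding sensitive_points_def by simp
qed

lemma sensitive_points_iff:
  fixes f :: "'a::metric_space \<Rightarrow> 'a"
  assumes "pointwise_weak_orbitally_convergent F f"
  shows "x \<in> sensitive_points f \<longleftrightarrow>
    (\<exists>\<delta>>0. \<forall>\<epsilon>>0. (\<Union>m\<in>{1..}. \<Inter>n\<in>{m..}. sensitive_pairs x (F n) \<epsilon> \<delta>) \<noteq> {})"
    (is "_ \<longleftrightarrow> ?R")
proof -
  note lim = pointwise_weak_orbitally_convergent_tendsto[OF assms]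
  \<comment> \<open>The conditions on \<open>y\<close> and \<open>k\<close> alone do not involve
    \<open>n\<close>, so they leave the eventual quantifier and only the distance condition stays
    inside.\<close>
  have R: "?R \<longleftrightarrow> (\<exists>\<delta>>0. \<forall>\<epsilon>>0. \<exists>y\<in>ball x \<epsilon>. \<exists>k\<ge>1.
      \<forall>\<^sub>F n in sequentially. dist ((F n ^^ k) x) ((F n ^^ k) y) > \<delta>)"
    unfolding UN_INT_eq_eventually sensitive_pairs_def
    by (simp add: eventually_conj_iff Bex_def conj_ac flip: ex_simps)
  show ?thesis
    unfolding R sensitive_points_iff_ball
  proof
    assume "\<exists>\<delta>>0. \<forall>\<epsilon>>0. \<exists>y\<in>ball x \<epsilon>. \<exists>k\<ge>1. dist ((f ^^ k) x) ((f ^^ k) y) > \<delta>"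
    then show "\<exists>\<delta>>0. \<forall>\<epsilon>>0. \<exists>y\<in>ball x \<epsilon>. \<exists>k\<ge>1.
      \<forall>\<^sub>F n in sequentially. dist ((F n ^^ k) x) ((F n ^^ k) y) > \<delta>"
      using eventually_dist_greater[OF lim lim] by meson
  next
    assume "\<exists>\<delta>>0. \<forall>\<epsilon>>0. \<exists>y\<in>ball x \<epsilon>. \<exists>k\<ge>1.
      \<forall>\<^sub>F n in sequentially. dist ((F n ^^ k) x) ((F n ^^ k) y) > \<delta>"
    then obtain \<delta> where "\<delta> > 0" and \<delta>: "\<forall>\<epsilon>>0. \<exists>y\<in>ball x \<epsilon>. \<exists>k\<ge>1.
      \<forall>\<^sub>F n in sequentially. dist ((F n ^^ k) x) ((F n ^^ k) y) > \<delta>" by auto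
    then have "\<forall>\<epsilon>>0. \<exists>y\<in>ball x \<epsilon>. \<exists>k\<ge>1. dist ((f ^^ k) x) ((f ^^ k) y) > \<delta> / 2"
      using dist_limit_greater_half[OF lim lim _ \<open>\<delta> > 0\<close>] by meson
    with \<open>\<delta> > 0\<close> show "\<exists>\<delta>>0. \<forall>\<epsilon>>0. \<exists>y\<in>ball x \<epsilon>. \<exists>k\<ge>1.
      dist ((f ^^ k) x) ((f ^^ k) y) > \<delta>" by (intro exI[of _ "\<delta> / 2"]) simp
  qed
qed

section \<open>Limits of periodic points\<close>

lemma periodic_limit_points_iff_ball:
  "x \<in> periodic_limit_points g \<longleftrightarrow> (\<forall>\<epsilon>>0. \<exists>z\<in>ball x \<epsilon> - {x}. periodic_point g z)"
proof
  assume "\<forall>\<epsilon>>0. \<exists>z\<in>ball x \<epsilon> - {x}. periodic_point g z"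
  then show "x \<in> periodic_limit_points g"
    unfolding periodic_limit_points_def open_contains_ball by blast
qed (simp add: periodic_limit_points_def)

lemma periodic_limit_points_iff:
  fixes f :: "'a::metric_space \<Rightarrow> 'a"
  assumes "pointwise_weak_orbitally_convergent F f"
  shows "x \<in> periodic_limit_points f \<longleftrightarrow>
    (\<forall>\<epsilon>>0. (\<Union>z \<in> ball x \<epsilon> - {x}. \<Inter>\<delta>\<in>{0<..}. \<Union>m\<in>{1..}. \<Inter>n\<in>{m..}.
      return_times (F n) z \<delta>) \<noteq> {})"
proof -
  \<comment> \<open>A member \<open>k\<close> of the intersection is one exponent for all
    \<open>\<delta>\<close>, while the threshold for \<open>n\<close> may vary with
    \<open>\<delta>\<close>. This is exactly convergence of \<open>(F n ^^ k) z\<close> to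
    \<open>z\<close>; the sequence also tends to \<open>(f ^^ k) z\<close>, so uniqueness of limits
    turns approximate returns into genuine periodicity.\<close>
  have "(\<Inter>\<delta>\<in>{0<..}. {k. \<forall>\<^sub>F n in sequentially. k \<in> return_times (F n) z \<delta>}) =
      {k. k \<ge> 1 \<and> (f ^^ k) z = z}" for z
  proof -
    have "(\<forall>\<delta>>0. \<forall>\<^sub>F n in sequentially. dist ((F n ^^ k) z) z < \<delta>) \<longleftrightarrow> (f ^^ k) z = z" for k
      using pointwise_weak_orbitally_convergent_tendsto[OF assms, of k z] LIMSEQ_unique
      unfolding tendsto_iff[symmetric] by metis
    \<comment> \<open>Pulling \<open>A\<close> out needs some positive \<open>\<delta>\<close> to
      exist; 1 serves.\<close>
    moreover have "(\<forall>\<delta>>0::real. A \<and> P \<delta>) \<longleftrightarrow> A \<and> (\<forall>\<delta>>0. P \<delta>)" for A P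
      using zero_less_one by blast
    ultimately show ?thesis
      unfolding set_eq_iff INT_iff Ball_def greaterThan_iff mem_Collect_eq return_times_def
      by (simp add: eventually_conj_iff)
  qed
  then have "(\<Union>z \<in> ball x \<epsilon> - {x}. \<Inter>\<delta>\<in>{0<..}. \<Union>m\<in>{1..}. \<Inter>n\<in>{m..}. return_times (F n) z \<delta>) \<noteq> {}
      \<longleftrightarrow> (\<exists>z\<in>ball x \<epsilon> - {x}. periodic_point f z)" for \<epsilon>
    unfolding UN_INT_eq_eventually periodic_point_def by auto
  then show ?thesis unfolding periodic_limit_points_iff_ball by simp
qed

section \<open>Transitive and mixing points\<close>

text \<open>The point \<open>y\<close> whose orbit under \<open>f\<close> enters \<open>V\<close> at
  time \<open>k\<close> also works for the maps \<open>F n\<close> eventually, because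
  \<open>V\<close> is a neighbourhood of the limit.\<close>

lemma hitting_times_subset_eventual:
  fixes f :: "'a::metric_space \<Rightarrow> 'a"
  assumes "pointwise_weak_orbitally_convergent F f" "open V"
  shows "hitting_times f x U V \<subseteq> snd ` (\<Union>m\<in>{1..}. \<Inter>n\<in>{m..}. hitting_pairs (F n) x U V)"
proof
  fix k assume "k \<in> hitting_times f x U V"
  then obtain y where "y \<in> U" "k \<ge> 1" "(f ^^ k) y \<in> V"
    unfolding hitting_times_def by auto
  then have "\<forall>\<^sub>F n in sequentially. (y, k) \<in> hitting_pairs (F n) x U V"
    using topological_tendstoD[OF pointwise_weak_orbitally_convergent_tendsto[OF assms(1)] assms(2)]
    by (simp add: hitting_pairs_def)
  then show "k \<in> snd ` (\<Union>m\<in>{1..}. \<Inter>n\<in>{m..}. hitting_pairs (F n) x U V)"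
    unfolding UN_INT_eq_eventually by force
qed

text \<open>A limit of points of \<open>W\<close> is only known to lie in \<open>closure W\<close>,
  hence the larger target \<open>V\<close> on the right.\<close>

lemma eventual_subset_hitting_times:
  fixes f :: "'a::metric_space \<Rightarrow> 'a"
  assumes "pointwise_weak_orbitally_convergent F f" "closure W \<subseteq> V"
  shows "snd ` (\<Union>m\<in>{1..}. \<Inter>n\<in>{m..}. hitting_pairs (F n) x U W) \<subseteq> hitting_times f x U V"
proof
  fix k assume "k \<in> snd ` (\<Union>m\<in>{1..}. \<Inter>n\<in>{m..}. hitting_pairs (F n) x U W)"
  then obtain y where "\<forall>\<^sub>F n in sequentially. y \<in> U \<and> k \<ge> 1 \<and> (F n ^^ k) y \<in> W"
    unfolding UN_INT_eq_eventually hitting_pairs_def by auto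
  then have y: "y \<in> U" "k \<ge> 1" and W: "\<forall>\<^sub>F n in sequentially. (F n ^^ k) y \<in> W"
    by (simp_all add: eventually_conj_iff)
  from W have "\<forall>\<^sub>F n in sequentially. (F n ^^ k) y \<in> closure W"
    by (rule eventually_mono) (use closure_subset in blast)
  then have "(f ^^ k) y \<in> closure W"
    by (rule Lim_in_closed_set[OF closed_closure _ sequentially_bot
          pointwise_weak_orbitally_convergent_tendsto[OF assms(1)]])
  with y assms(2) show "k \<in> hitting_times f x U V"
    unfolding hitting_times_def by blast
qed

lemma open_contains_closure_of_open:
  fixes V :: "'a::metric_space set"
  assumes "open V" "V \<noteq> {}"
  obtains W where "open W" "W \<noteq> {}" "closure W \<subseteq> V"
proof -
  from assms obtain v e where "e > 0" "cball v e \<subseteq> V"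
    unfolding open_contains_cball by blast
  moreover have "closure (ball v e) \<subseteq> cball v e"
    by (simp add: closure_minimal)
  \<comment> \<open>The open ball serves as \<open>W\<close>; its closure may be smaller than the
    closed ball, but the inclusion is enough.\<close>
  ultimately show ?thesis using that[of "ball v e"] by auto
qed

text \<open>Covers both transitivity and mixing, which differ only in the upward closed property \<open>Q\<close>.\<close>

lemma hitting_times_property_iff:
  fixes f :: "'a::metric_space \<Rightarrow> 'a"
  assumes conv: "pointwise_weak_orbitally_convergent F f"
    and mono: "\<And>A B. Q A \<Longrightarrow> A \<subseteq> B \<Longrightarrow> B \<subseteq> {1..} \<Longrightarrow> Q B"
  shows "(\<forall>U V. open U \<and> x \<in> U \<and> open V \<and> V \<noteq> {} \<longrightarrow> Q (hitting_times f x U V)) \<longleftrightarrow>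
    (\<forall>U V. open U \<and> x \<in> U \<and> open V \<and> V \<noteq> {} \<longrightarrow>
      Q (snd ` (\<Union>m\<in>{1..}. \<Inter>n\<in>{m..}. hitting_pairs (F n) x U V)))" (is "?L \<longleftrightarrow> ?R")
proof
  \<comment> \<open>\<open>mono\<close> enlarges sets only within the positive integers, where
    cofiniteness is measured, so the larger set must be bounded first.\<close>
  have pos: "snd ` (\<Union>m\<in>{1..}. \<Inter>n\<in>{m..}. hitting_pairs (F n) x U V) \<subseteq> {1..}" for U V
    by (fastforce simp: hitting_pairs_def)
  show ?R if ?L
    using that mono[OF _ hitting_times_subset_eventual[OF conv] pos] by blast
next
  assume R: ?R
  show ?L
  proof (intro allI impI)
    fix U V :: "'a set" assume UV: "open U \<and> x \<in> U \<and> open V \<and> V \<noteq> {}"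
    then obtain W where W: "open W" "W \<noteq> {}" "closure W \<subseteq> V"
      by (metis open_contains_closure_of_open)
    \<comment> \<open>\<open>?R\<close> is applied to the shrunken target \<open>W\<close>, so that
      passing to the limit lands back in \<open>V\<close>.\<close>
    have "Q (snd ` (\<Union>m\<in>{1..}. \<Inter>n\<in>{m..}. hitting_pairs (F n) x U W))"
      using R UV W by blast
    then show "Q (hitting_times f x U V)"
      by (rule mono[OF _ eventual_subset_hitting_times[OF conv W(3)]])
        (auto simp: hitting_times_def)
  qed
qed

lemma transitive_points_iff:
  fixes f :: "'a::metric_space \<Rightarrow> 'a"
  assumes "pointwise_weak_orbitally_convergent F f"
  shows "x \<in> transitive_points f \<longleftrightarrow>
    (\<forall>U V. open U \<and> x \<in> U \<and> open V \<and> V \<noteq> {} \<longrightarrow>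
      (\<Union>m\<in>{1..}. \<Inter>n\<in>{m..}. hitting_pairs (F n) x U V) \<noteq> {})"
  \<comment> \<open>Nonemptiness is upward closed and is unaffected by the projection
    \<open>snd\<close>.\<close>
  using hitting_times_property_iff[OF assms, where Q = "\<lambda>A. A \<noteq> {}" and x = x]
  unfolding transitive_points_def image_is_empty mem_Collect_eq by blast

lemma cofinite_in_pos_mono:
  "cofinite_in_pos A \<Longrightarrow> A \<subseteq> B \<Longrightarrow> B \<subseteq> {1..} \<Longrightarrow> cofinite_in_pos B"
  unfolding cofinite_in_pos_def by (meson Diff_mono finite_subset order_refl)

lemma mixing_points_iff:
  fixes f :: "'a::metric_space \<Rightarrow> 'a"
  assumes "pointwise_weak_orbitally_convergent F f"
  shows "x \<in> mixing_points f \<longleftrightarrow>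
    (\<forall>U V. open U \<and> x \<in> U \<and> open V \<and> V \<noteq> {} \<longrightarrow>
      cofinite_in_pos (snd ` (\<Union>m\<in>{1..}. \<Inter>n\<in>{m..}. hitting_pairs (F n) x U V)))"
  using hitting_times_property_iff[OF assms cofinite_in_pos_mono, where x = x]
  unfolding mixing_points_def mem_Collect_eq .

theorem theorem3p3:
  fixes F :: "nat \<Rightarrow> 'a::metric_space \<Rightarrow> 'a" and f :: "'a \<Rightarrow> 'a" and x :: 'a
  assumes "\<And>n. n \<ge> 1 \<Longrightarrow> uniformly_continuous_on UNIV (F n)"
    and "uniformly_continuous_on UNIV f"
    and "pointwise_weak_orbitally_convergent F f"
  shows
    "(x \<in> pos_expansive_points f \<longleftrightarrow>
        (\<exists>\<delta>>0. \<forall>y. y \<noteq> x \<longrightarrow>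
           (\<Union>m\<in>{1..}. \<Inter>n\<in>{m..}. pos_expansive_times x (F n) y \<delta>) \<noteq> {})) \<and>
     (x \<in> sensitive_points f \<longleftrightarrow>
        (\<exists>\<delta>>0. \<forall>\<epsilon>>0.
           (\<Union>m\<in>{1..}. \<Inter>n\<in>{m..}. sensitive_pairs x (F n) \<epsilon> \<delta>) \<noteq> {})) \<and>
     (x \<in> periodic_limit_points f \<longleftrightarrow>
        (\<forall>\<epsilon>>0. (\<Union>z \<in> ball x \<epsilon> - {x}. \<Inter>\<delta>\<in>{0<..}. \<Union>m\<in>{1..}. \<Inter>n\<in>{m..}.
           return_times (F n) z \<delta>) \<noteq> {})) \<and>
     (x \<in> transitive_points f \<longleftrightarrow>
        (\<forall>U V. open U \<and> x \<in> U \<and> open V \<and> V \<noteq> {} \<longrightarrow>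
           (\<Union>m\<in>{1..}. \<Inter>n\<in>{m..}. hitting_pairs (F n) x U V) \<noteq> {})) \<and>
     (x \<in> mixing_points f \<longleftrightarrow>
        (\<forall>U V. open U \<and> x \<in> U \<and> open V \<and> V \<noteq> {} \<longrightarrow>
           cofinite_in_pos (snd ` (\<Union>m\<in>{1..}. \<Inter>n\<in>{m..}. hitting_pairs (F n) x U V)))) \<and>
     (uniform_equivalence f \<and> (\<forall>n\<ge>1. uniform_equivalence (F n)) \<and>
      pointwise_weak_orbitally_convergent (\<lambda>n. inv (F n)) (inv f) \<longrightarrow>
        (x \<in> expansive_points f \<longleftrightarrow>
          (\<exists>\<delta>>0. \<forall>y. y \<noteq> x \<longrightarrow>
             (\<Union>m\<in>{1..}. \<Inter>n\<in>{m..}. expansive_times x (F n) y \<delta>) \<noteq> {})))"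
  \<comment> \<open>Five conjuncts are the equivalences above; in the last, the premises supply the
    convergence of the inverses required by \<open>expansive_points_iff\<close>.\<close>
  by (intro conjI impI; (elim conjE)?)
    (fact pos_expansive_points_iff[OF assms(3)] sensitive_points_iff[OF assms(3)]
      periodic_limit_points_iff[OF assms(3)] transitive_points_iff[OF assms(3)]
      mixing_points_iff[OF assms(3)] | rule expansive_points_iff[OF assms(3)], assumption)+

end
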